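(* Let $G$ be a connected graph with adjacency matrix $A$, signless Laplacian $Q$, Laplacian $L$ and normalized Laplacian $\mathcal{L}$. Throughout, $r$ denotes a positive integer and $f$ a polynomial. (1) If $G$ is regular, then $X^r=f(Y)$ can occur (that is, such $r$ and $f$ exist) if $X,Y$ are any of $A,Q,L$ or $\mathcal{L}$. Moreover, all of these matrices can be related to one another by a linear equation. (2) If $G$ is $(d_1,d_2)$-biregular, then $X^r=f(Y)$ can occur (that is, such $r$ and $f$ exist) if $X=A$ and $Y=Q$, $L$ or $\mathcal{L}$, or when $X=\mathcal{L}$ and $Y=A$. Specifically, $$(Q-d_1I)(Q-d_2I)=(L-d_1I)(L-d_2I)=A^2,\qquad \mathcal{L}=I-\frac{1}{\sqrt{d_1d_2}}A.$$ Moreover, if $(X,Y)$ is any other ordered pair of distinct matrices from $A,Q,L,\mathcal{L}$ (that is, $(Q,A),(L,A),(Q,L),(L,Q),(\mathcal{L},Q),(Q,\mathcal{L}),(\mathcal{L},L),(L,\mathcal{L})$), then no such relation $X^r=f(Y)$ exists. (3) If $G$ is not regular or biregular (that is, neither regular nor biregular), then $X^r=f(Y)$ cannot hold if $X,Y$ are any distinct matrices of $A,Q,L,\mathcal{L}$, except possibly for the case $A^r=f(\mathcal{L})$.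
   Context: Graphs are finite and simple. For a graph $G$, $A$ is the adjacency matrix, $D$ is the diagonal matrix of vertex degrees, $Q=D+A$ is the signless Laplacian, $L=D-A$ is the Laplacian, and, when $G$ has no isolated vertices, $\mathcal{L}=D^{-1/2}LD^{-1/2}$ is the normalized Laplacian. $I$ is the identity matrix. $G$ is $(d_1,d_2)$-biregular if there is a partition $V_1\cup V_2$ of its vertex set such that no two vertices of the same $V_i$ are adjacent and every $v\in V_i$ has degree $d_i$; $G$ is biregular if it is $(d_1,d_2)$-biregular for some $d_1,d_2$. $G$ is regular if all vertices have the same degree.
   Formalization: In (2), the claim that no relation exists for the other ordered pairs is stated only for biregular graphs that are not regular; for regular biregular graphs (d_1=d_2, e.g. K_2, where Q=A+I) it is false and contradicts (1). *)

theory Defs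
  imports "HOL-Analysis.Analysis" "HOL-Computational_Algebra.Polynomial"
begin

text \<open>
  A finite simple graph is given by its adjacency relation on a finite type \<open>'n\<close>, all of
  whose elements are the vertices, so that its matrices have type \<open>real ^ 'n ^ 'n\<close>.
\<close>

definition simple_graph :: "('n::finite \<Rightarrow> 'n \<Rightarrow> bool) \<Rightarrow> bool" where
  "simple_graph E \<longleftrightarrow> symp E \<and> irreflp E"

definition connected_graph :: "('n::finite \<Rightarrow> 'n \<Rightarrow> bool) \<Rightarrow> bool" where
  "connected_graph E \<longleftrightarrow> (\<forall>u v. E\<^sup>*\<^sup>* u v)"

definition vdeg :: "('n::finite \<Rightarrow> 'n \<Rightarrow> bool) \<Rightarrow> 'n \<Rightarrow> nat" where
  "vdeg E v = card {w. E v w}"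

definition no_isolated_vertices :: "('n::finite \<Rightarrow> 'n \<Rightarrow> bool) \<Rightarrow> bool" where
  "no_isolated_vertices E \<longleftrightarrow> (\<forall>v. vdeg E v \<noteq> 0)"

definition regular_graph :: "('n::finite \<Rightarrow> 'n \<Rightarrow> bool) \<Rightarrow> bool" where
  "regular_graph E \<longleftrightarrow> (\<forall>u v. vdeg E u = vdeg E v)"

definition biregular_with :: "('n::finite \<Rightarrow> 'n \<Rightarrow> bool) \<Rightarrow> nat \<Rightarrow> nat \<Rightarrow> bool" where
  "biregular_with E d1 d2 \<longleftrightarrow>
     (\<exists>V1 V2. V1 \<union> V2 = UNIV \<and> V1 \<inter> V2 = {} \<and>
        (\<forall>u\<in>V1. \<forall>v\<in>V1. \<not> E u v) \<and> (\<forall>u\<in>V2. \<forall>v\<in>V2. \<not> E u v) \<and>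
        (\<forall>v\<in>V1. vdeg E v = d1) \<and> (\<forall>v\<in>V2. vdeg E v = d2))"

definition biregular_graph :: "('n::finite \<Rightarrow> 'n \<Rightarrow> bool) \<Rightarrow> bool" where
  "biregular_graph E \<longleftrightarrow> (\<exists>d1 d2. biregular_with E d1 d2)"

definition adj_mat :: "('n::finite \<Rightarrow> 'n \<Rightarrow> bool) \<Rightarrow> real ^ 'n ^ 'n" where
  "adj_mat E = (\<chi> i j. if E i j then 1 else 0)"

definition diag_mat :: "('n::finite \<Rightarrow> real) \<Rightarrow> real ^ 'n ^ 'n" where
  "diag_mat c = (\<chi> i j. if i = j then c i else 0)"

definition deg_mat :: "('n::finite \<Rightarrow> 'n \<Rightarrow> bool) \<Rightarrow> real ^ 'n ^ 'n" where
  "deg_mat E = diag_mat (\<lambda>v. real (vdeg E v))"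

definition signless_laplacian :: "('n::finite \<Rightarrow> 'n \<Rightarrow> bool) \<Rightarrow> real ^ 'n ^ 'n" where
  "signless_laplacian E = deg_mat E + adj_mat E"

definition laplacian :: "('n::finite \<Rightarrow> 'n \<Rightarrow> bool) \<Rightarrow> real ^ 'n ^ 'n" where
  "laplacian E = deg_mat E - adj_mat E"

text \<open>The matrix \<open>D\<^sup>-\<^sup>1\<^sup>/\<^sup>2\<close>; meaningful only for graphs without isolated vertices.\<close>

definition deg_mat_inv_sqrt :: "('n::finite \<Rightarrow> 'n \<Rightarrow> bool) \<Rightarrow> real ^ 'n ^ 'n" where
  "deg_mat_inv_sqrt E = diag_mat (\<lambda>v. 1 / sqrt (real (vdeg E v)))"

definition normalized_laplacian :: "('n::finite \<Rightarrow> 'n \<Rightarrow> bool) \<Rightarrow> real ^ 'n ^ 'n" where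
  "normalized_laplacian E = deg_mat_inv_sqrt E ** laplacian E ** deg_mat_inv_sqrt E"

text \<open>
  Powers with respect to the matrix product: \<open>*\<close> and \<open>^\<close> on \<open>real ^ 'n ^ 'n\<close> are the
  componentwise operations.
\<close>

primrec mat_pow :: "real ^ 'n ^ 'n \<Rightarrow> nat \<Rightarrow> real ^ 'n::finite ^ 'n" where
  "mat_pow M 0 = mat 1"
| "mat_pow M (Suc k) = M ** mat_pow M k"

definition mat_poly :: "real poly \<Rightarrow> real ^ 'n ^ 'n \<Rightarrow> real ^ 'n::finite ^ 'n" where
  "mat_poly f M = (\<Sum>i\<le>degree f. coeff f i *\<^sub>R mat_pow M i)"

definition power_eq_poly :: "real ^ 'n ^ 'n \<Rightarrow> real ^ 'n::finite ^ 'n \<Rightarrow> bool" where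
  "power_eq_poly X Y \<longleftrightarrow> (\<exists>r>0. \<exists>f. mat_pow X r = mat_poly f Y)"

end

theory Submission
  imports Defs
begin

text \<open>
  For a regular graph the four matrices are affine functions of one another, and for a biregular
  graph the displayed identities are checked entrywise; these identities give the positive parts.

  All negative parts rest on commutation.  If \<open>X\<^sup>r = f(Y)\<close> then \<open>X\<^sup>r\<close> commutes with \<open>Y\<close>, and when \<open>X\<close>
  is positive semidefinite and \<open>Y\<close> is symmetric, \<open>X\<close> itself commutes with \<open>Y\<close>
  (\<open>commute_from_mat_pow\<close>).  This applies to \<open>X = Q\<close>, \<open>L\<close>, \<open>\<L>\<close>; since \<open>A\<close> is indefinite, it is
  applied to \<open>A\<^sup>2\<close> in the case \<open>A\<^sup>r = f(Y)\<close>, where \<open>(A\<^sup>2)\<^sup>r = f(Y)\<^sup>2\<close> also commutes with \<open>Y\<close>.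

  It remains to see which of these matrices commute.  If any two of \<open>A\<close>, \<open>Q\<close>, \<open>L\<close> commute, then \<open>A\<close>
  commutes with \<open>D\<close>, so adjacent vertices have equal degrees and the connected graph is regular.
  The graph is regular also if \<open>\<L>\<close> commutes with \<open>Q\<close> (compare the entries at an edge) or with
  \<open>L\<close> (compare the kernels, spanned by \<open>D\<^sup>1\<^sup>/\<^sup>2 1\<close> and the all-ones vector \<open>1\<close>).  If \<open>\<L>\<close> commutes with \<open>A\<close>, or
  \<open>A\<^sup>2\<close> with \<open>Q\<close> or \<open>L\<close>, then any two vertices with a common neighbour have equal degrees.  In a
  connected graph the degrees then alternate between two values along every walk, so that the
  graph is regular or biregular (\<open>regular_or_biregularI\<close>).
\<close>

section \<open>Powers and polynomials of matrices\<close>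

lemma mat_pow_commute:
  assumes "X ** Y = Y ** X"
  shows "mat_pow X k ** Y = Y ** mat_pow X k"
proof (induction k)
  case (Suc k)
  have "mat_pow X (Suc k) ** Y = X ** (mat_pow X k ** Y)"
    by (simp add: matrix_mul_assoc)
  also have "\<dots> = Y ** mat_pow X (Suc k)"
    by (simp add: Suc matrix_mul_assoc assms)
  finally show ?case .
qed simp

lemma mat_pow_Suc_right: "mat_pow X (Suc k) = mat_pow X k ** X"
  using mat_pow_commute[of X X k] by simp

lemma mat_pow_square: "mat_pow (X ** X) k = mat_pow X k ** mat_pow X k"
proof (induction k)
  case (Suc k)
  have "mat_pow (X ** X) (Suc k) = X ** (X ** mat_pow X k) ** mat_pow X k"
    by (simp add: Suc matrix_mul_assoc)
  also have "\<dots> = mat_pow X (Suc k) ** mat_pow X (Suc k)"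
    by (metis mat_pow.simps(2) mat_pow_Suc_right matrix_mul_assoc)
  finally show ?case .
qed simp

lemma transpose_mat_pow: "transpose X = X \<Longrightarrow> transpose (mat_pow X k) = mat_pow X k"
proof (induction k)
  case (Suc k)
  then show ?case
    using mat_pow_Suc_right[of X k] by (simp add: matrix_transpose_mul)
qed (simp add: transpose_mat)

lemma matrix_add_rdistrib: "(X + Y) ** Z = X ** Z + Y ** Z"
  by (simp add: vec_eq_iff matrix_matrix_mult_def sum.distrib distrib_right)

lemma matrix_diff_ldistrib: "Z ** (X - Y) = Z ** X - Z ** (Y :: real ^ 'n::finite ^ 'n)"
  by (simp add: vec_eq_iff matrix_matrix_mult_def sum_subtractf right_diff_distrib)

lemma matrix_diff_rdistrib: "(X - Y) ** Z = X ** Z - (Y :: real ^ 'n::finite ^ 'n) ** Z"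
  by (simp add: vec_eq_iff matrix_matrix_mult_def sum_subtractf left_diff_distrib)

lemma scaleR_matrix_mult: "(a *\<^sub>R X) ** Y = a *\<^sub>R (X ** (Y :: real ^ 'n::finite ^ 'n))"
  by (simp add: vec_eq_iff matrix_matrix_mult_def sum_distrib_left mult.assoc)

lemma matrix_mult_scaleR: "X ** (a *\<^sub>R Y) = a *\<^sub>R (X ** (Y :: real ^ 'n::finite ^ 'n))"
  by (simp add: vec_eq_iff matrix_matrix_mult_def sum_distrib_left mult_ac)

lemma mat_poly_commute: "mat_poly f Y ** Y = Y ** mat_poly f (Y :: real ^ 'n::finite ^ 'n)"
proof -
  have "(\<Sum>i\<in>S. coeff f i *\<^sub>R mat_pow Y i) ** Y = Y ** (\<Sum>i\<in>S. coeff f i *\<^sub>R mat_pow Y i)"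
    if "finite S" for S
    using that
  proof (induction S)
    case (insert i S)
    then show ?case
      by (simp add: matrix_add_ldistrib matrix_add_rdistrib mat_pow_commute
          scaleR_matrix_mult matrix_mult_scaleR)
  qed (simp add: matrix_matrix_mult_def)
  then show ?thesis
    by (simp add: mat_poly_def)
qed

lemma power_eq_poly_linear:
  assumes "X = a *\<^sub>R Y + b *\<^sub>R mat 1"
  shows "power_eq_poly X Y"
proof -
  have "mat_pow X 1 = mat_poly [:b, a:] Y"
    using assms by (auto simp: mat_poly_def)
  then show ?thesis
    unfolding power_eq_poly_def by (metis zero_less_one)
qed

lemma power_eq_poly_quadratic:
  assumes "(Y - p *\<^sub>R mat 1) ** (Y - q *\<^sub>R mat 1) = mat_pow X 2"
  shows "power_eq_poly X Y"
proof -
  have "mat_poly [:p * q, - (p + q), 1:] Y = (Y - p *\<^sub>R mat 1) ** (Y - q *\<^sub>R mat 1)"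
    by (simp add: mat_poly_def numeral_2_eq_2 matrix_diff_ldistrib matrix_diff_rdistrib
        scaleR_matrix_mult matrix_mult_scaleR algebra_simps)
  then show ?thesis
    using assms unfolding power_eq_poly_def by (metis zero_less_numeral)
qed

section \<open>Positive semidefiniteness by traces\<close>

text \<open>
  The quadratic form of \<open>M\<close> is nonnegative; \<open>M\<close> need not be symmetric.
\<close>

definition psd_form :: "real ^ 'n::finite ^ 'n \<Rightarrow> bool" where
  "psd_form M \<longleftrightarrow> (\<forall>x. 0 \<le> x \<bullet> (M *v x))"

text \<open>
  Positive semidefiniteness of a symmetric matrix, in dual form: \<open>X\<close> pairs nonnegatively with every
  matrix whose quadratic form is nonnegative.  In this form products such as \<open>tr(C\<^sup>T P C R) \<ge> 0\<close> for
  positive semidefinite \<open>P\<close> and \<open>R\<close> are available without square roots of matrices or the spectral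
  theorem.
\<close>

definition trace_positive :: "real ^ 'n::finite ^ 'n \<Rightarrow> bool" where
  "trace_positive X \<longleftrightarrow> transpose X = X \<and> (\<forall>M. psd_form M \<longrightarrow> 0 \<le> trace (M ** X))"

lemma inner_transpose: "x \<bullet> (transpose K *v y) = (K *v x) \<bullet> (y :: real ^ 'n::finite)"
  for K :: "real ^ 'm::finite ^ 'n"
  by (metis dot_lmul_matrix inner_commute transpose_matrix_vector)

lemma inner_symmetric:
  "transpose X = X \<Longrightarrow> x \<bullet> (X *v y) = (X *v x) \<bullet> (y :: real ^ 'n::finite)"
  using inner_transpose[of x X y] by simp

lemma psd_form_congruence:
  assumes "psd_form M"
  shows "psd_form (transpose K ** M ** K)"
  using assms
  by (simp add: psd_form_def inner_transpose flip: matrix_vector_mul_assoc del: transpose_matrix_vector)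

lemma psd_form_trace_positive:
  fixes X :: "real ^ 'n::finite ^ 'n"
  assumes "trace_positive X"
  shows "psd_form X"
  unfolding psd_form_def
proof
  fix x :: "real ^ 'n"
  \<comment> \<open>The rank one matrix \<open>x x\<^sup>T\<close> turns the trace pairing into the quadratic form at \<open>x\<close>.\<close>
  define M :: "real ^ 'n ^ 'n" where "M = (\<chi> i j. x $ i * x $ j)"
  have "y \<bullet> (M *v y) = (x \<bullet> y)\<^sup>2" for y
    by (simp add: M_def inner_vec_def matrix_vector_mult_def power2_eq_square sum_product
        sum_distrib_left mult_ac)
  then have "psd_form M"
    by (simp add: psd_form_def)
  moreover have "trace (M ** X) = x \<bullet> (X *v x)"
    unfolding trace_def inner_vec_def matrix_vector_mult_def matrix_matrix_mult_def M_def
    by (simp add: sum_distrib_left) (subst sum.swap, intro sum.cong refl, simp add: mult_ac)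
  ultimately show "0 \<le> x \<bullet> (X *v x)"
    using assms by (auto simp: trace_positive_def)
qed

lemma trace_positive_mat_1: "trace_positive (mat 1 :: real ^ 'n::finite ^ 'n)"
proof -
  have "0 \<le> M $ i $ i" if "psd_form M" for M :: "real ^ 'n ^ 'n" and i
    using that[unfolded psd_form_def, rule_format, of "axis i 1"]
    by (simp add: inner_axis' column_def matrix_vector_mult_basis)
  then show ?thesis
    by (auto simp: trace_positive_def transpose_mat trace_def intro: sum_nonneg)
qed

lemma trace_positive_congruence:
  assumes "trace_positive X"
  shows "trace_positive (transpose K ** X ** K)"
  unfolding trace_positive_def
proof (intro conjI allI impI)
  show "transpose (transpose K ** X ** K) = transpose K ** X ** K"
    using assms by (simp add: trace_positive_def matrix_transpose_mul matrix_mul_assoc)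
next
  fix M :: "real ^ 'b ^ 'b"
  assume "psd_form M"
  then have "psd_form (K ** M ** transpose K)"
    using psd_form_congruence[of M "transpose K"] by simp
  then have "0 \<le> trace (K ** M ** transpose K ** X)"
    using assms by (simp add: trace_positive_def)
  also have "\<dots> = trace (M ** (transpose K ** X ** K))"
    using trace_mul_sym[of K "M ** transpose K ** X"] by (simp add: matrix_mul_assoc)
  finally show "0 \<le> trace (M ** (transpose K ** X ** K))" .
qed

lemma trace_positive_mat_pow:
  assumes "trace_positive X"
  shows "trace_positive (mat_pow X k)"
proof (induction k rule: less_induct)
  case (less k)
  consider "k = 0" | "k = 1" | l where "k = Suc (Suc l)"
    by (metis One_nat_def not0_implies_Suc)
  then show ?case
  proof cases
    case 3
    have X: "transpose X = X"
      using assms by (simp add: trace_positive_def)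
    \<comment> \<open>Powers are built up from \<open>X\<^sup>0\<close> and \<open>X\<^sup>1\<close> by the congruence \<open>X\<^sup>l\<^sup>+\<^sup>2 = X\<^sup>T X\<^sup>l X\<close>.\<close>
    have "mat_pow X k = transpose X ** mat_pow X l ** X"
      unfolding X 3 by (metis mat_pow.simps(2) mat_pow_Suc_right)
    then show ?thesis
      using trace_positive_congruence[OF less.IH, of l X] 3 by simp
  qed (use assms trace_positive_mat_1 in simp_all)
qed

lemma psd_form_kernel:
  assumes "transpose X = X" and "psd_form X" and z: "z \<bullet> (X *v z) = 0"
  shows "X *v z = 0"
proof (rule ccontr)
  define w where "w = X *v z"
  define q where "q = w \<bullet> (X *v w)"
  define p where "p = w \<bullet> w"
  assume "X *v z \<noteq> 0"
  then have p: "p > 0"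
    by (simp add: p_def w_def)
  have q: "q \<ge> 0"
    using assms(2) by (simp add: q_def psd_form_def)
  \<comment> \<open>A small step from \<open>z\<close> against \<open>X z\<close> would make the quadratic form negative.\<close>
  define t where "t = - p / (q + 1)"
  have "0 \<le> (z + t *\<^sub>R w) \<bullet> (X *v (z + t *\<^sub>R w))"
    using assms(2) by (simp add: psd_form_def)
  also have "\<dots> = 2 * t * p + t\<^sup>2 * q"
    using z inner_symmetric[OF assms(1), of z w]
    by (simp add: p_def q_def w_def algebra_simps power2_eq_square matrix_vector_right_distrib
        inner_add_left inner_add_right matrix_vector_mult_scaleR)
  also have "\<dots> = - (p / (q + 1))\<^sup>2 * (q + 2)"
    using q by (simp add: t_def power2_eq_square divide_simps) (simp add: algebra_simps)
  also have "\<dots> < 0"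
    using p q by (simp add: mult_neg_pos)
  finally show False by simp
qed

lemma mat_pow_kernel:
  assumes X: "transpose X = X" and "mat_pow X (Suc k) *v z = 0"
  shows "X *v z = 0"
  using assms(2)
proof (induction k)
  case (Suc k)
  let ?w = "mat_pow X (Suc k) *v z"
  have "?w \<bullet> ?w = (mat_pow X k *v z) \<bullet> (X *v ?w)"
    using inner_symmetric[OF X, of "mat_pow X k *v z" ?w] by (simp add: matrix_vector_mul_assoc)
  also have "\<dots> = 0"
    using Suc.prems by (simp add: matrix_vector_mul_assoc)
  finally show ?case
    using Suc.IH by simp
qed simp

text \<open>
  Let \<open>C = XY - YX\<close>.  The telescoping identity
  \<open>X\<^sup>r Y - Y X\<^sup>r = (\<Sum>i<r. X\<^sup>i C X\<^sup>r\<^sup>-\<^sup>1\<^sup>-\<^sup>i)\<close> gives \<open>(\<Sum>i<r. tr(C\<^sup>T X\<^sup>i C X\<^sup>r\<^sup>-\<^sup>1\<^sup>-\<^sup>i)) = 0\<close>, a sum of nonnegative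
  terms.  The vanishing of the last term yields \<open>X\<^sup>r\<^sup>-\<^sup>1 C = 0\<close>, hence \<open>C = 0\<close> or \<open>X C = 0\<close>.  In the
  latter case \<open>C X = 0\<close> too, because \<open>C\<close> is skew-symmetric, and \<open>tr(C\<^sup>2) = 0\<close> follows, which again
  forces \<open>C = 0\<close>.
\<close>

lemma commute_from_mat_pow:
  fixes X Y :: "real ^ 'n::finite ^ 'n"
  assumes tp: "trace_positive X" and Y: "transpose Y = Y" and "r > 0"
    and comm: "mat_pow X r ** Y = Y ** mat_pow X r"
  shows "X ** Y = Y ** X"
proof -
  define C where "C = X ** Y - Y ** X"
  have X: "transpose X = X"
    using tp by (simp add: trace_positive_def)
  have C: "transpose C = - C"
    using X Y by (simp add: C_def transpose_def vec_eq_iff matrix_matrix_mult_def mult.commute)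
  \<comment> \<open>The differences of the sequence \<open>T\<close> are the nonnegative terms of the telescoping sum.\<close>
  define T where "T i = trace (transpose C ** (mat_pow X i ** Y ** mat_pow X (r - i)))" for i
  have T_diff: "T (Suc i) - T i = trace (transpose C ** mat_pow X i ** C ** mat_pow X (r - Suc i))"
    if "i < r" for i
  proof -
    have "r - i = Suc (r - Suc i)"
      using that by simp
    then have 1: "mat_pow X i ** Y ** mat_pow X (r - i) = mat_pow X i ** (Y ** X) ** mat_pow X (r - Suc i)"
      by (simp add: matrix_mul_assoc)
    have 2: "mat_pow X (Suc i) ** Y ** mat_pow X (r - Suc i)
        = mat_pow X i ** (X ** Y) ** mat_pow X (r - Suc i)"
      using mat_pow_Suc_right[of X i] by (simp add: matrix_mul_assoc)
    show ?thesis
      unfolding T_def 1 2 C_def trace_sub[symmetric]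
      by (simp add: matrix_mul_assoc matrix_diff_ldistrib matrix_diff_rdistrib)
  qed
  have nonneg: "0 \<le> T (Suc i) - T i" if "i < r" for i
  proof -
    have "psd_form (transpose C ** mat_pow X i ** C)"
      by (intro psd_form_congruence psd_form_trace_positive trace_positive_mat_pow tp)
    then show ?thesis
      unfolding T_diff[OF that] using trace_positive_mat_pow[OF tp] by (auto simp: trace_positive_def)
  qed
  obtain m where r: "r = Suc m"
    using \<open>r > 0\<close> gr0_conv_Suc by blast
  have "(\<Sum>i<r. T (Suc i) - T i) = 0"
    using comm unfolding sum_lessThan_telescope by (simp add: T_def)
  then have "T (Suc m) - T m = 0"
    using nonneg sum_nonneg_eq_0_iff[of "{..<r}" "\<lambda>i. T (Suc i) - T i"] r by auto
  then have "trace (transpose C ** mat_pow X m ** C) = 0"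
    using T_diff[of m] r by simp
  moreover have "trace (transpose C ** mat_pow X m ** C)
      = (\<Sum>j\<in>UNIV. column j C \<bullet> (mat_pow X m *v column j C))"
    by (simp add: trace_def matrix_mul_assoc[symmetric])
      (simp add: matrix_matrix_mult_def inner_vec_def transpose_def column_def matrix_vector_mult_def)
  moreover have psd: "psd_form (mat_pow X m)"
    by (intro psd_form_trace_positive trace_positive_mat_pow tp)
  ultimately have "column j C \<bullet> (mat_pow X m *v column j C) = 0" for j
    by (simp add: psd_form_def sum_nonneg_eq_0_iff)
  then have kernel: "mat_pow X m *v column j C = 0" for j
    by (intro psd_form_kernel transpose_mat_pow X psd)
  show ?thesis
  proof (cases m)
    case 0
    then have "C = 0"
      using kernel by (simp add: vec_eq_iff column_def)
    then show ?thesis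
      by (simp add: C_def)
  next
    case (Suc k)
    have "X *v column j C = 0" for j
      using mat_pow_kernel[OF X] kernel Suc by metis
    then have XC: "X ** C = 0"
      by (simp add: vec_eq_iff column_def matrix_vector_mult_def matrix_matrix_mult_def)
    have CX: "C ** X = 0"
    proof -
      have "transpose (X ** C) = (- C) ** X"
        by (simp only: matrix_transpose_mul X C)
      also have "\<dots> = - (C ** X)"
        by (simp add: vec_eq_iff matrix_matrix_mult_def sum_negf)
      finally have "transpose (X ** C) = - (C ** X)" .
      then show ?thesis
        using XC by (simp add: vec_eq_iff transpose_def)
    qed
    \<comment> \<open>Expanding only the second factor of \<open>C\<^sup>2\<close> leaves factors \<open>C X\<close> and, cyclically, \<open>X C\<close>.\<close>
    have "trace (C ** C) = trace (C ** X ** Y) - trace (C ** Y ** X)"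
      by (simp add: trace_sub[symmetric] matrix_mul_assoc C_def matrix_diff_ldistrib)
    also have "trace (C ** Y ** X) = trace (X ** C ** Y)"
      using trace_mul_sym[of "C ** Y" X] by (simp add: matrix_mul_assoc)
    finally have "trace (C ** C) = 0"
      by (simp add: XC CX trace_def)
    moreover have "C $ i $ j * C $ j $ i = - (C $ i $ j)\<^sup>2" for i j
    proof -
      have "C $ j $ i = transpose C $ i $ j"
        by (simp add: transpose_def)
      then show ?thesis
        unfolding C by (simp add: power2_eq_square)
    qed
    then have "trace (C ** C) = - (\<Sum>i\<in>UNIV. \<Sum>j\<in>UNIV. (C $ i $ j)\<^sup>2)"
      by (simp add: trace_def matrix_matrix_mult_def sum_negf)
    ultimately have "C = 0"
      by (simp add: vec_eq_iff sum_nonneg_eq_0_iff sum_nonneg)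
    then show ?thesis
      by (simp add: C_def)
  qed
qed

lemma power_eq_poly_commute:
  assumes "power_eq_poly X Y" "trace_positive X" "transpose Y = Y"
  shows "X ** Y = Y ** X"
  using assms commute_from_mat_pow mat_poly_commute unfolding power_eq_poly_def by metis


section \<open>Graph matrices and their positivity\<close>

lemma diag_mat_mult: "(diag_mat c ** X) $ i $ j = c i * X $ i $ j"
  by (simp add: diag_mat_def matrix_matrix_mult_def if_distrib if_distribR cong: if_cong)

lemma mult_diag_mat: "(X ** diag_mat c) $ i $ j = X $ i $ j * c j"
  by (simp add: diag_mat_def matrix_matrix_mult_def if_distrib if_distribR cong: if_cong)

lemma transpose_diag_mat: "transpose (diag_mat c) = diag_mat c"
  by (simp add: diag_mat_def transpose_def vec_eq_iff)

lemma transpose_adj_mat: "simple_graph E \<Longrightarrow> transpose (adj_mat E) = adj_mat E"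
  by (auto simp: simple_graph_def symp_def adj_mat_def transpose_def vec_eq_iff)

lemma adj_mat_sym: "simple_graph E \<Longrightarrow> adj_mat E $ u $ v = adj_mat E $ v $ u"
  by (auto simp: simple_graph_def symp_def adj_mat_def)

lemma vdeg_sum: "real (vdeg E u) = (\<Sum>v\<in>UNIV. adj_mat E $ u $ v)"
  by (simp add: adj_mat_def vdeg_def sum.If_cases)

text \<open>
  For \<open>\<sigma> = 1\<close> and \<open>\<sigma> = -1\<close> these are the signless Laplacian and the Laplacian: both are sums of
  \<open>(e\<^sub>u + \<sigma> e\<^sub>v)(e\<^sub>u + \<sigma> e\<^sub>v)\<^sup>T\<close> over the edges \<open>uv\<close>, counted below as ordered pairs and hence twice.
\<close>

lemma trace_positive_signed:
  fixes E :: "'n::finite \<Rightarrow> 'n \<Rightarrow> bool"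
  assumes E: "simple_graph E" and \<sigma>: "\<sigma> * \<sigma> = (1::real)"
  shows "trace_positive (deg_mat E + \<sigma> *\<^sub>R adj_mat E)" (is "trace_positive ?X")
  unfolding trace_positive_def
proof (intro conjI allI impI)
  show "transpose ?X = ?X"
    using adj_mat_sym[OF E] by (simp add: transpose_def vec_eq_iff deg_mat_def diag_mat_def)
next
  fix M :: "real ^ 'n ^ 'n"
  assume M: "psd_form M"
  let ?A = "adj_mat E"
  let ?q = "\<lambda>u v. M $ u $ u + M $ v $ v + \<sigma> * (M $ u $ v + M $ v $ u)"
  have q: "0 \<le> ?q u v" for u v
  proof -
    \<comment> \<open>\<open>?q u v\<close> is the value of the quadratic form of \<open>M\<close> at \<open>e\<^sub>u + \<sigma> e\<^sub>v\<close>.\<close>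
    let ?x = "axis u 1 + \<sigma> *\<^sub>R axis v (1::real)"
    have "?x \<bullet> (M *v ?x) = M $ u $ u + (\<sigma> * \<sigma>) * M $ v $ v + \<sigma> * (M $ u $ v + M $ v $ u)"
      by (simp add: matrix_vector_right_distrib matrix_vector_mult_scaleR inner_add_left inner_axis'
          matrix_vector_mult_basis column_def algebra_simps)
    then show ?thesis
      using M \<sigma> by (metis (no_types, lifting) mult_1 psd_form_def)
  qed
  have D: "trace (M ** deg_mat E) = (\<Sum>u\<in>UNIV. \<Sum>v\<in>UNIV. ?A $ u $ v * M $ u $ u)"
    by (simp add: trace_def deg_mat_def mult_diag_mat vdeg_sum sum_distrib_left mult.commute)
  also have "\<dots> = (\<Sum>u\<in>UNIV. \<Sum>v\<in>UNIV. ?A $ u $ v * M $ v $ v)"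
    by (subst sum.swap) (simp add: adj_mat_sym[OF E])
  finally have D': "trace (M ** deg_mat E) = (\<Sum>u\<in>UNIV. \<Sum>v\<in>UNIV. ?A $ u $ v * M $ v $ v)" .
  have A: "trace (M ** ?A) = (\<Sum>u\<in>UNIV. \<Sum>v\<in>UNIV. ?A $ u $ v * M $ u $ v)"
    unfolding trace_def matrix_matrix_mult_def
    by (simp, intro sum.cong refl) (metis adj_mat_sym[OF E] mult.commute)
  also have "\<dots> = (\<Sum>u\<in>UNIV. \<Sum>v\<in>UNIV. ?A $ u $ v * M $ v $ u)"
    by (subst sum.swap) (simp add: adj_mat_sym[OF E])
  finally have A': "trace (M ** ?A) = (\<Sum>u\<in>UNIV. \<Sum>v\<in>UNIV. ?A $ u $ v * M $ v $ u)" .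
  have "trace (M ** (\<sigma> *\<^sub>R ?A)) = \<sigma> * trace (M ** ?A)"
    by (simp add: matrix_mult_scaleR trace_def sum_distrib_left)
  then have "2 * trace (M ** ?X) = (trace (M ** deg_mat E) + trace (M ** deg_mat E))
      + \<sigma> * (trace (M ** ?A) + trace (M ** ?A))"
    by (simp add: matrix_add_ldistrib trace_add algebra_simps)
  also have "\<dots> = (\<Sum>u\<in>UNIV. \<Sum>v\<in>UNIV. ?A $ u $ v * ?q u v)"
    by (subst (1) D, subst D', subst (1) A, subst A')
      (simp add: sum.distrib sum_distrib_left algebra_simps)
  also have "\<dots> \<ge> 0"
    by (intro sum_nonneg mult_nonneg_nonneg q) (simp add: adj_mat_def)
  finally show "0 \<le> trace (M ** ?X)" by simp
qed

lemma trace_positive_signless_laplacian: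
  "simple_graph E \<Longrightarrow> trace_positive (signless_laplacian E)"
  using trace_positive_signed[of E 1] by (simp add: signless_laplacian_def)

lemma trace_positive_laplacian: "simple_graph E \<Longrightarrow> trace_positive (laplacian E)"
  using trace_positive_signed[of E "-1"] by (simp add: laplacian_def)

lemma trace_positive_normalized_laplacian:
  "simple_graph E \<Longrightarrow> trace_positive (normalized_laplacian E)"
  using trace_positive_congruence[OF trace_positive_laplacian, of E "deg_mat_inv_sqrt E"]
  by (simp add: normalized_laplacian_def deg_mat_inv_sqrt_def transpose_diag_mat)

lemma trace_positive_adj_square:
  assumes "simple_graph E"
  shows "trace_positive (adj_mat E ** adj_mat E)"
  using trace_positive_congruence[OF trace_positive_mat_1, of "adj_mat E"]
  by (simp add: transpose_adj_mat assms)

text \<open>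
  The substitute for \<open>power_eq_poly_commute\<close> for the indefinite matrix \<open>A\<close>.
\<close>

lemma power_eq_poly_adj_commute:
  assumes E: "simple_graph E" and "power_eq_poly (adj_mat E) Y" and Y: "transpose Y = Y"
  shows "(adj_mat E ** adj_mat E) ** Y = Y ** (adj_mat E ** adj_mat E)"
proof -
  obtain r f where "r > 0" and f: "mat_pow (adj_mat E) r = mat_poly f Y"
    using assms(2) by (auto simp: power_eq_poly_def)
  have "mat_pow (adj_mat E ** adj_mat E) r ** Y = Y ** mat_pow (adj_mat E ** adj_mat E) r"
  proof -
    have "mat_poly f Y ** mat_poly f Y ** Y = mat_poly f Y ** (Y ** mat_poly f Y)"
      by (simp only: mat_poly_commute flip: matrix_mul_assoc)
    also have "\<dots> = Y ** (mat_poly f Y ** mat_poly f Y)"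
      by (simp only: mat_poly_commute matrix_mul_assoc)
    finally show ?thesis
      by (simp only: mat_pow_square f)
  qed
  then show ?thesis
    using commute_from_mat_pow trace_positive_adj_square[OF E] Y \<open>r > 0\<close> by blast
qed

section \<open>Degree conditions for regular and biregular graphs\<close>

lemma regular_graphI:
  assumes "connected_graph E" and "\<And>u v. E u v \<Longrightarrow> vdeg E u = vdeg E v"
  shows "regular_graph E"
  unfolding regular_graph_def
proof (intro allI)
  fix u v
  have "E\<^sup>*\<^sup>* u v"
    using assms(1) by (simp add: connected_graph_def)
  then show "vdeg E u = vdeg E v"
    by induction (simp_all add: assms(2))
qed

lemma exists_neighbour: "no_isolated_vertices E \<Longrightarrow> \<exists>w. E v w"
  unfolding no_isolated_vertices_def vdeg_def by (metis card.empty empty_Collect_eq)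

text \<open>
  If \<open>a\<close> and \<open>b\<close> are the degrees of the ends of one edge, then by connectedness every edge has ends
  of degrees \<open>a\<close> and \<open>b\<close>; for \<open>a \<noteq> b\<close> the two degree classes are the parts of the bipartition.
\<close>

lemma regular_or_biregularI:
  assumes "simple_graph E" "connected_graph E" "no_isolated_vertices E"
    and common: "\<And>u v w. E u w \<Longrightarrow> E v w \<Longrightarrow> vdeg E u = vdeg E v"
  shows "regular_graph E \<or> biregular_graph E"
proof -
  have sym: "E u v \<Longrightarrow> E v u" for u v
    using assms(1) by (auto simp: simple_graph_def symp_def)
  obtain u0 v0 where uv0: "E u0 v0"
    using exists_neighbour[OF assms(3)] by blast
  define a b where "a = vdeg E u0" and "b = vdeg E v0"
  have edge: "vdeg E x = a \<and> vdeg E y = b \<or> vdeg E x = b \<and> vdeg E y = a" if "E x y" for x y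
  proof -
    have "E\<^sup>*\<^sup>* u0 x"
      using assms(2) by (simp add: connected_graph_def)
    then show ?thesis
      using that
    proof (induction arbitrary: y)
      case base
      then show ?case
        using common[of y u0 v0] sym uv0 by (auto simp: a_def b_def)
    next
      case (step x x')
      then show ?case
        using common[of x x' y] sym by metis
    qed
  qed
  show ?thesis
  proof (cases "a = b")
    case True
    then show ?thesis
      using regular_graphI[OF assms(2)] edge by metis
  next
    case False
    have "biregular_with E a b"
      unfolding biregular_with_def
    proof (intro exI conjI)
      show "{v. vdeg E v = a} \<union> {v. vdeg E v = b} = UNIV"
        using edge exists_neighbour[OF assms(3)] by blast
    qed (use edge False in fastforce)+
    then show ?thesis
      by (auto simp: biregular_graph_def)
  qed
qed

section \<open>Commutation among the adjacency matrix and the two Laplacians\<close>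

lemma degree_commute_regular:
  assumes "connected_graph E" and "deg_mat E ** adj_mat E = adj_mat E ** deg_mat E"
  shows "regular_graph E"
proof (rule regular_graphI[OF assms(1)])
  fix u v
  assume "E u v"
  moreover have "(deg_mat E ** adj_mat E) $ u $ v = (adj_mat E ** deg_mat E) $ u $ v"
    by (simp add: assms(2))
  ultimately show "vdeg E u = vdeg E v"
    by (simp add: deg_mat_def diag_mat_mult mult_diag_mat) (simp add: adj_mat_def)
qed

lemma signless_adj_commute_regular:
  assumes "connected_graph E"
    and "signless_laplacian E ** adj_mat E = adj_mat E ** signless_laplacian E"
  shows "regular_graph E"
  using assms
  by (intro degree_commute_regular)
    (simp_all add: signless_laplacian_def matrix_add_ldistrib matrix_add_rdistrib)

lemma laplacian_adj_commute_regular: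
  assumes "connected_graph E"
    and "laplacian E ** adj_mat E = adj_mat E ** laplacian E"
  shows "regular_graph E"
  using assms
  by (intro degree_commute_regular)
    (simp_all add: laplacian_def matrix_diff_ldistrib matrix_diff_rdistrib)

lemma signless_laplacian_commute_regular:
  assumes "connected_graph E"
    and "signless_laplacian E ** laplacian E = laplacian E ** signless_laplacian E"
  shows "regular_graph E"
proof (rule degree_commute_regular[OF assms(1)])
  let ?D = "deg_mat E" and ?A = "adj_mat E"
  have "2 *\<^sub>R (?A ** ?D) = 2 *\<^sub>R (?D ** ?A)"
    using assms(2)
    by (simp add: laplacian_def signless_laplacian_def matrix_diff_ldistrib matrix_diff_rdistrib
        matrix_add_ldistrib matrix_add_rdistrib scaleR_2 algebra_simps)
  then show "?D ** ?A = ?A ** ?D" by simp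
qed

lemma adj_square_commute_common:
  assumes E: "simple_graph E"
    and "(adj_mat E ** adj_mat E) ** deg_mat E = deg_mat E ** (adj_mat E ** adj_mat E)"
    and uw: "E u w" and vw: "E v w"
  shows "vdeg E u = vdeg E v"
proof -
  let ?A = "adj_mat E"
  have "E w v"
    using E vw by (auto simp: simple_graph_def symp_def)
  then have "(\<Sum>x\<in>UNIV. ?A $ u $ x * ?A $ x $ v) > 0"
    using uw by (intro sum_pos2[of _ w]) (auto simp: adj_mat_def)
  then have "(?A ** ?A) $ u $ v > 0"
    by (simp add: matrix_matrix_mult_def)
  moreover have "((?A ** ?A) ** deg_mat E) $ u $ v = (deg_mat E ** (?A ** ?A)) $ u $ v"
    by (simp add: assms(2))
  ultimately show ?thesis
    by (simp add: deg_mat_def diag_mat_mult mult_diag_mat)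
qed

lemma adj_square_signless_commute:
  "(adj_mat E ** adj_mat E) ** signless_laplacian E = signless_laplacian E ** (adj_mat E ** adj_mat E)
    \<Longrightarrow> (adj_mat E ** adj_mat E) ** deg_mat E = deg_mat E ** (adj_mat E ** adj_mat E)"
  by (simp add: signless_laplacian_def matrix_add_ldistrib matrix_add_rdistrib matrix_mul_assoc)

lemma adj_square_laplacian_commute:
  "(adj_mat E ** adj_mat E) ** laplacian E = laplacian E ** (adj_mat E ** adj_mat E)
    \<Longrightarrow> (adj_mat E ** adj_mat E) ** deg_mat E = deg_mat E ** (adj_mat E ** adj_mat E)"
  by (simp add: laplacian_def matrix_diff_ldistrib matrix_diff_rdistrib matrix_mul_assoc)

section \<open>Commutation with the normalized Laplacian\<close>

text \<open>
  The normalized adjacency matrix \<open>D\<^sup>-\<^sup>1\<^sup>/\<^sup>2 A D\<^sup>-\<^sup>1\<^sup>/\<^sup>2\<close>.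
\<close>

definition normalized_adj :: "('n::finite \<Rightarrow> 'n \<Rightarrow> bool) \<Rightarrow> real ^ 'n ^ 'n" where
  "normalized_adj E = deg_mat_inv_sqrt E ** adj_mat E ** deg_mat_inv_sqrt E"

lemma normalized_adj_entry:
  "normalized_adj E $ u $ v = adj_mat E $ u $ v / (sqrt (vdeg E u) * sqrt (vdeg E v))"
  by (simp add: normalized_adj_def deg_mat_inv_sqrt_def diag_mat_mult mult_diag_mat)

lemma normalized_laplacian_eq:
  assumes "no_isolated_vertices E"
  shows "normalized_laplacian E = mat 1 - normalized_adj E"
proof -
  have "vdeg E u \<noteq> 0" for u
    using assms by (simp add: no_isolated_vertices_def)
  then have "deg_mat_inv_sqrt E ** deg_mat E ** deg_mat_inv_sqrt E = mat 1"
    by (simp add: vec_eq_iff deg_mat_inv_sqrt_def deg_mat_def diag_mat_mult mult_diag_mat)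
      (simp add: diag_mat_def mat_def)
  then show ?thesis
    by (simp add: normalized_laplacian_def laplacian_def normalized_adj_def
        matrix_diff_ldistrib matrix_diff_rdistrib)
qed

lemma normalized_commute_iff:
  assumes "no_isolated_vertices E"
  shows "normalized_laplacian E ** X = X ** normalized_laplacian E
    \<longleftrightarrow> normalized_adj E ** X = X ** normalized_adj E"
  by (simp add: normalized_laplacian_eq[OF assms] matrix_diff_ldistrib matrix_diff_rdistrib)

text \<open>
  The \<open>(u, v)\<close> entry of \<open>A D\<^sup>-\<^sup>1\<^sup>/\<^sup>2 A\<close>: the walks of length two from \<open>u\<close> to \<open>v\<close>, each weighted by the
  inverse square root of the degree of its middle vertex.
\<close>

definition weighted_walks :: "('n::finite \<Rightarrow> 'n \<Rightarrow> bool) \<Rightarrow> 'n \<Rightarrow> 'n \<Rightarrow> real" where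
  "weighted_walks E u v = (\<Sum>w\<in>UNIV. adj_mat E $ u $ w * (1 / sqrt (vdeg E w)) * adj_mat E $ w $ v)"

lemma adj_normalized_adj_entry:
  "(adj_mat E ** normalized_adj E) $ u $ v = weighted_walks E u v / sqrt (vdeg E v)"
  "(normalized_adj E ** adj_mat E) $ u $ v = weighted_walks E u v / sqrt (vdeg E u)"
  by (simp_all add: matrix_matrix_mult_def[of "adj_mat E" "normalized_adj E"]
      matrix_matrix_mult_def[of "normalized_adj E" "adj_mat E"]
      normalized_adj_entry weighted_walks_def sum_divide_distrib field_simps)

lemma weighted_walks_nonneg: "0 \<le> weighted_walks E u v"
  by (auto simp: weighted_walks_def adj_mat_def intro!: sum_nonneg)

text \<open>
  The entries of the two products differ only by the factors \<open>d(v)\<^sup>-\<^sup>1\<^sup>/\<^sup>2\<close> and \<open>d(u)\<^sup>-\<^sup>1\<^sup>/\<^sup>2\<close> of the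
  weighted number of walks of length two, which is positive if \<open>u\<close> and \<open>v\<close> have a common neighbour.
\<close>

lemma normalized_adj_commute_common:
  assumes E: "simple_graph E" "no_isolated_vertices E"
    and comm: "normalized_laplacian E ** adj_mat E = adj_mat E ** normalized_laplacian E"
    and uw: "E u w" and vw: "E v w"
  shows "vdeg E u = vdeg E v"
proof -
  have d: "vdeg E x \<noteq> 0" for x
    using E by (simp add: no_isolated_vertices_def)
  have "E w v"
    using E vw by (auto simp: simple_graph_def symp_def)
  then have "weighted_walks E u v > 0"
    unfolding weighted_walks_def
    using uw d by (intro sum_pos2[of _ w]) (auto simp: adj_mat_def)
  moreover have "(adj_mat E ** normalized_adj E) $ u $ v = (normalized_adj E ** adj_mat E) $ u $ v"
    using comm normalized_commute_iff[OF E(2)] by metis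
  ultimately show ?thesis
    using d by (simp add: adj_normalized_adj_entry)
qed

text \<open>
  With \<open>K\<close> the weighted number of walks of length two, commutation reads
  \<open>(d(v) - d(u)) A\<^sub>u\<^sub>v (d(u) d(v))\<^sup>-\<^sup>1\<^sup>/\<^sup>2 = (d(v)\<^sup>-\<^sup>1\<^sup>/\<^sup>2 - d(u)\<^sup>-\<^sup>1\<^sup>/\<^sup>2) K\<close> at the entry \<open>(u, v)\<close>.  At an edge with
  \<open>d(u) < d(v)\<close> the left-hand side is positive while the right-hand side is at most zero.
\<close>

lemma normalized_signless_commute_regular:
  assumes E: "simple_graph E" "connected_graph E" "no_isolated_vertices E"
    and comm: "normalized_laplacian E ** signless_laplacian E
      = signless_laplacian E ** normalized_laplacian E"
  shows "regular_graph E"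
proof (rule regular_graphI[OF E(2)])
  have no_less: "\<not> vdeg E u < vdeg E v" if "E u v" for u v
  proof
    assume less: "vdeg E u < vdeg E v"
    have u: "vdeg E u > 0"
      using E(3) by (simp add: no_isolated_vertices_def)
    have "(normalized_adj E ** signless_laplacian E) $ u $ v
        = (signless_laplacian E ** normalized_adj E) $ u $ v"
      using comm normalized_commute_iff[OF E(3)] by metis
    then have "normalized_adj E $ u $ v * vdeg E v + weighted_walks E u v / sqrt (vdeg E u)
        = vdeg E u * normalized_adj E $ u $ v + weighted_walks E u v / sqrt (vdeg E v)"
      by (simp add: signless_laplacian_def matrix_add_ldistrib matrix_add_rdistrib
          adj_normalized_adj_entry deg_mat_def diag_mat_mult mult_diag_mat)
    moreover have "weighted_walks E u v / sqrt (vdeg E v) \<le> weighted_walks E u v / sqrt (vdeg E u)"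
      using less u by (intro divide_left_mono weighted_walks_nonneg) auto
    moreover have "normalized_adj E $ u $ v > 0"
      using that less u by (simp add: normalized_adj_entry) (simp add: adj_mat_def)
    then have "normalized_adj E $ u $ v * vdeg E u < normalized_adj E $ u $ v * vdeg E v"
      using less by simp
    ultimately show False
      by (simp add: mult.commute)
  qed
  show "vdeg E u = vdeg E v" if "E u v" for u v
    using no_less[of u v] no_less[of v u] that E(1)
    by (auto simp: simple_graph_def symp_def)
qed

lemma laplacian_mult_entry:
  "(laplacian E *v x) $ u = (\<Sum>v\<in>UNIV. adj_mat E $ u $ v * (x $ u - x $ v))"
proof -
  have "(deg_mat E *v x) $ u = vdeg E u * x $ u"
    by (simp add: deg_mat_def diag_mat_def matrix_vector_mult_def if_distrib if_distribR cong: if_cong)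
  then show ?thesis
    by (simp add: laplacian_def matrix_vector_mult_diff_rdistrib vdeg_sum sum_distrib_right
        right_diff_distrib sum_subtractf)
      (simp add: matrix_vector_mult_def)
qed

text \<open>
  The maximum principle: at a vertex where \<open>x\<close> is maximal, \<open>(L x)(u) = 0\<close> forces all neighbours to
  share the maximal value.
\<close>

lemma laplacian_kernel:
  assumes "connected_graph E" and "laplacian E *v x = 0"
  shows "x $ u = x $ v"
proof -
  have "Max (range (($) x)) \<in> range (($) x)"
    by (intro Max_in) auto
  then obtain m where "Max (range (($) x)) = x $ m"
    by (rule rangeE)
  then have m: "x $ w \<le> x $ m" for w
    by (metis Max_ge finite finite_imageI rangeI)
  have "x $ w = x $ m" for w
  proof -
    have "E\<^sup>*\<^sup>* m w"
      using assms(1) by (simp add: connected_graph_def)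
    then show ?thesis
    proof induction
      case (step y z)
      have "(\<Sum>v\<in>UNIV. adj_mat E $ y $ v * (x $ y - x $ v)) = 0"
        using assms(2) laplacian_mult_entry[of E x y] by simp
      moreover have "0 \<le> adj_mat E $ y $ v * (x $ y - x $ v)" for v
        using m[of v] step.IH by (simp add: adj_mat_def)
      ultimately have "adj_mat E $ y $ z * (x $ y - x $ z) = 0"
        by (simp add: sum_nonneg_eq_0_iff)
      then show ?case
        using step by (simp add: adj_mat_def)
    qed simp
  qed
  then show ?thesis by metis
qed

text \<open>
  For \<open>L\<close> the comparison of entries is inconclusive, because the walks of length two occur with the
  opposite sign.  Instead \<open>L (\<L> 1) = \<L> (L 1) = 0\<close> shows that \<open>\<L> 1\<close> is a constant vector; it is
  orthogonal to the positive vector \<open>D\<^sup>1\<^sup>/\<^sup>2 1\<close> in the kernel of \<open>\<L>\<close>, hence zero.  So \<open>D\<^sup>-\<^sup>1\<^sup>/\<^sup>2 1\<close> is in the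
  kernel of \<open>L\<close>, that is, constant.
\<close>

lemma normalized_laplacian_commute_regular:
  assumes E: "simple_graph E" "connected_graph E" "no_isolated_vertices E"
    and comm: "normalized_laplacian E ** laplacian E = laplacian E ** normalized_laplacian E"
  shows "regular_graph E"
proof -
  define j :: "real ^ 'a" where "j = (\<chi> v. 1)"
  define s :: "real ^ 'a" where "s = (\<chi> v. sqrt (vdeg E v))"
  let ?N = "normalized_laplacian E" and ?L = "laplacian E" and ?S = "deg_mat_inv_sqrt E"
  have d: "vdeg E v \<noteq> 0" for v
    using E(3) by (simp add: no_isolated_vertices_def)
  have S: "(?S *v x) $ v = x $ v / sqrt (vdeg E v)" for x v
    by (simp add: deg_mat_inv_sqrt_def diag_mat_def matrix_vector_mult_def if_distrib if_distribR
        cong: if_cong)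
  have N: "?N *v x = ?S *v (?L *v (?S *v x))" for x
    by (simp add: normalized_laplacian_def matrix_vector_mul_assoc matrix_mul_assoc)
  have Lj: "?L *v j = 0"
    by (simp add: vec_eq_iff laplacian_mult_entry j_def)
  have "?S *v s = j"
    using d by (simp add: vec_eq_iff S s_def j_def)
  then have Ns: "?N *v s = 0"
    by (simp add: N Lj)
  have "?L *v (?N *v j) = 0"
    using comm Lj by (metis matrix_vector_mul_assoc matrix_vector_mult_0_right)
  then obtain c where c: "\<And>v. (?N *v j) $ v = c"
    using laplacian_kernel[OF E(2)] by metis
  have "s \<bullet> (?N *v j) = 0"
    using inner_symmetric[of ?N s j] trace_positive_normalized_laplacian[OF E(1)] Ns
    by (simp add: trace_positive_def)
  then have "c * (\<Sum>v\<in>UNIV. sqrt (vdeg E v)) = 0"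
    by (simp add: inner_vec_def c s_def sum_distrib_left mult.commute)
  moreover have "(\<Sum>v\<in>UNIV. sqrt (vdeg E v)) > 0"
    using d by (intro sum_pos) auto
  ultimately have "c = 0" by simp
  then have "(?S *v (?L *v (?S *v j))) $ v = 0" for v
    using c N by metis
  then have "?L *v (?S *v j) = 0"
    unfolding S using d by (simp add: vec_eq_iff)
  then have "(?S *v j) $ u = (?S *v j) $ v" for u v
    using laplacian_kernel[OF E(2)] by blast
  then show ?thesis
    using d by (simp add: S j_def regular_graph_def)
qed

section \<open>Identities for regular and biregular graphs\<close>

lemma regular_graph_matrices:
  assumes "regular_graph E" "no_isolated_vertices E"
  obtains d where "d > 0" "signless_laplacian E = 1 *\<^sub>R adj_mat E + d *\<^sub>R mat 1"
    "laplacian E = (-1) *\<^sub>R adj_mat E + d *\<^sub>R mat 1"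
    "normalized_laplacian E = (- 1 / d) *\<^sub>R adj_mat E + 1 *\<^sub>R mat 1"
proof -
  obtain k where k: "\<And>v. vdeg E v = k"
    using assms(1) unfolding regular_graph_def by metis
  have "k > 0"
    using k assms(2) by (simp add: no_isolated_vertices_def)
  have D: "deg_mat E = real k *\<^sub>R mat 1"
    by (simp add: vec_eq_iff deg_mat_def diag_mat_def mat_def k)
  show thesis
  proof
    show "real k > 0" using \<open>k > 0\<close> by simp
    show "signless_laplacian E = 1 *\<^sub>R adj_mat E + real k *\<^sub>R mat 1"
      by (simp add: signless_laplacian_def D)
    show "laplacian E = (-1) *\<^sub>R adj_mat E + real k *\<^sub>R mat 1"
      by (simp add: laplacian_def D)
    show "normalized_laplacian E = (- 1 / real k) *\<^sub>R adj_mat E + 1 *\<^sub>R mat 1"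
      by (simp add: vec_eq_iff normalized_laplacian_eq[OF assms(2)] normalized_adj_entry k)
  qed
qed

lemma regular_graph_affine:
  fixes E :: "'n::finite \<Rightarrow> 'n \<Rightarrow> bool"
  defines "\<M> \<equiv> {adj_mat E, signless_laplacian E, laplacian E, normalized_laplacian E}"
  assumes E: "regular_graph E" "no_isolated_vertices E" and "X \<in> \<M>" "Y \<in> \<M>"
  shows "\<exists>a b. a \<noteq> 0 \<and> X = a *\<^sub>R Y + b *\<^sub>R mat 1"
proof -
  obtain d where "d > 0" and matrices: "signless_laplacian E = 1 *\<^sub>R adj_mat E + d *\<^sub>R mat 1"
      "laplacian E = (-1) *\<^sub>R adj_mat E + d *\<^sub>R mat 1"
      "normalized_laplacian E = (- 1 / d) *\<^sub>R adj_mat E + 1 *\<^sub>R mat 1"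
    using regular_graph_matrices[OF E] by blast
  have affine: "\<exists>a b. a \<noteq> 0 \<and> Z = a *\<^sub>R adj_mat E + b *\<^sub>R mat 1" if "Z \<in> \<M>" for Z
  proof -
    have "adj_mat E = 1 *\<^sub>R adj_mat E + 0 *\<^sub>R mat 1"
      by simp
    moreover have nz: "(1::real) \<noteq> 0" "(- 1::real) \<noteq> 0" "- 1 / d \<noteq> 0"
      using \<open>d > 0\<close> by simp_all
    moreover have "Z = adj_mat E \<or> Z = signless_laplacian E \<or> Z = laplacian E
        \<or> Z = normalized_laplacian E"
      using that by (simp add: \<M>_def)
    ultimately show ?thesis
      using matrices by (elim disjE) blast+
  qed
  obtain a b where X: "a \<noteq> 0" "X = a *\<^sub>R adj_mat E + b *\<^sub>R mat 1"
    using affine \<open>X \<in> \<M>\<close> by blast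
  obtain a' b' where Y: "a' \<noteq> 0" "Y = a' *\<^sub>R adj_mat E + b' *\<^sub>R mat 1"
    using affine \<open>Y \<in> \<M>\<close> by blast
  have "X = (a / a') *\<^sub>R Y + (b - a / a' * b') *\<^sub>R mat 1"
    using Y(1) by (simp add: X Y(2) algebra_simps)
  moreover have "a / a' \<noteq> 0"
    using X Y by simp
  ultimately show ?thesis by blast
qed

lemma biregular_with_degrees:
  assumes "biregular_with E d1 d2"
  shows "vdeg E v = d1 \<or> vdeg E v = d2"
    and "E u v \<Longrightarrow> vdeg E u = d1 \<and> vdeg E v = d2 \<or> vdeg E u = d2 \<and> vdeg E v = d1"
  using assms unfolding biregular_with_def by (metis UNIV_I Un_iff)+

text \<open>
  The diagonal parts multiply to zero because every degree is \<open>d1\<close> or \<open>d2\<close>, and the mixed terms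
  cancel because the degrees of the two ends of an edge add up to \<open>d1 + d2\<close>.
\<close>

lemma biregular_product:
  assumes "biregular_with E d1 d2" and \<sigma>: "\<sigma> * \<sigma> = (1::real)"
  shows "(deg_mat E + \<sigma> *\<^sub>R adj_mat E - real d1 *\<^sub>R mat 1)
    ** (deg_mat E + \<sigma> *\<^sub>R adj_mat E - real d2 *\<^sub>R mat 1) = mat_pow (adj_mat E) 2"
proof -
  let ?A = "adj_mat E"
  let ?D = "\<lambda>c. diag_mat (\<lambda>v. real (vdeg E v) - real c)"
  have shift: "deg_mat E + \<sigma> *\<^sub>R ?A - real c *\<^sub>R mat 1 = ?D c + \<sigma> *\<^sub>R ?A" for c
    by (simp add: vec_eq_iff deg_mat_def diag_mat_def mat_def)
  have 1: "?D d1 ** ?D d2 = 0"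
    using biregular_with_degrees(1)[OF assms(1)]
    by (simp add: vec_eq_iff diag_mat_mult) (auto simp: diag_mat_def)
  have 2: "?D d1 ** ?A + ?A ** ?D d2 = 0"
    using biregular_with_degrees(2)[OF assms(1)]
    by (simp add: vec_eq_iff diag_mat_mult mult_diag_mat) (fastforce simp: adj_mat_def)
  have "(?D d1 + \<sigma> *\<^sub>R ?A) ** (?D d2 + \<sigma> *\<^sub>R ?A)
      = ?D d1 ** ?D d2 + \<sigma> *\<^sub>R (?D d1 ** ?A + ?A ** ?D d2) + (\<sigma> * \<sigma>) *\<^sub>R (?A ** ?A)"
    by (simp add: matrix_add_ldistrib matrix_add_rdistrib scaleR_matrix_mult matrix_mult_scaleR
        algebra_simps)
  also have "\<dots> = mat_pow ?A 2"
    by (simp add: 1 2 \<sigma> numeral_2_eq_2)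
  finally show ?thesis
    unfolding shift .
qed

lemma biregular_normalized_laplacian:
  assumes "biregular_with E d1 d2" "no_isolated_vertices E"
  shows "normalized_laplacian E = mat 1 - (1 / sqrt (real d1 * real d2)) *\<^sub>R adj_mat E"
proof -
  have "normalized_adj E $ u $ v = (1 / sqrt (real d1 * real d2)) * adj_mat E $ u $ v" for u v
    using biregular_with_degrees(2)[OF assms(1), of u v]
    by (auto simp: normalized_adj_entry adj_mat_def real_sqrt_mult)
  then show ?thesis
    by (simp add: normalized_laplacian_eq[OF assms(2)] vec_eq_iff)
qed

lemma biregular_power_eq_poly_adj_normalized:
  assumes "biregular_with E d1 d2" "no_isolated_vertices E"
  shows "power_eq_poly (adj_mat E) (normalized_laplacian E)"
    and "power_eq_poly (normalized_laplacian E) (adj_mat E)"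
proof -
  define c where "c = sqrt (real d1 * real d2)"
  obtain u v where "E u v"
    using exists_neighbour[OF assms(2)] by blast
  then have "d1 \<noteq> 0" "d2 \<noteq> 0"
    using biregular_with_degrees(2)[OF assms(1)] assms(2) by (metis no_isolated_vertices_def)+
  then have "c \<noteq> 0"
    by (simp add: c_def)
  have N: "normalized_laplacian E = mat 1 - (1 / c) *\<^sub>R adj_mat E"
    using biregular_normalized_laplacian[OF assms] by (simp add: c_def)
  then have "normalized_laplacian E = (- (1 / c)) *\<^sub>R adj_mat E + 1 *\<^sub>R mat 1"
    by simp
  then show "power_eq_poly (normalized_laplacian E) (adj_mat E)"
    by (rule power_eq_poly_linear)
  have "adj_mat E = (- c) *\<^sub>R normalized_laplacian E + c *\<^sub>R mat 1"
    using \<open>c \<noteq> 0\<close> by (simp add: N algebra_simps)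
  then show "power_eq_poly (adj_mat E) (normalized_laplacian E)"
    by (rule power_eq_poly_linear)
qed

section \<open>Powers of one matrix as polynomials in another\<close>

lemma transpose_graph_matrices:
  assumes "simple_graph E"
  shows "transpose (signless_laplacian E) = signless_laplacian E"
    and "transpose (laplacian E) = laplacian E"
    and "transpose (normalized_laplacian E) = normalized_laplacian E"
  using trace_positive_signless_laplacian[OF assms] trace_positive_laplacian[OF assms]
    trace_positive_normalized_laplacian[OF assms]
  by (simp_all only: trace_positive_def)

lemma power_eq_poly_regular:
  assumes E: "simple_graph E" "connected_graph E" "no_isolated_vertices E"
  shows "power_eq_poly (signless_laplacian E) (adj_mat E) \<Longrightarrow> regular_graph E"
    and "power_eq_poly (laplacian E) (adj_mat E) \<Longrightarrow> regular_graph E"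
    and "power_eq_poly (signless_laplacian E) (laplacian E) \<Longrightarrow> regular_graph E"
    and "power_eq_poly (laplacian E) (signless_laplacian E) \<Longrightarrow> regular_graph E"
    and "power_eq_poly (normalized_laplacian E) (signless_laplacian E) \<Longrightarrow> regular_graph E"
    and "power_eq_poly (signless_laplacian E) (normalized_laplacian E) \<Longrightarrow> regular_graph E"
    and "power_eq_poly (normalized_laplacian E) (laplacian E) \<Longrightarrow> regular_graph E"
    and "power_eq_poly (laplacian E) (normalized_laplacian E) \<Longrightarrow> regular_graph E"
proof -
  note sym = transpose_adj_mat[OF E(1)] transpose_graph_matrices[OF E(1)]
  note Q = power_eq_poly_commute[OF _ trace_positive_signless_laplacian[OF E(1)]]
  note L = power_eq_poly_commute[OF _ trace_positive_laplacian[OF E(1)]]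
  note N = power_eq_poly_commute[OF _ trace_positive_normalized_laplacian[OF E(1)]]
  show "power_eq_poly (signless_laplacian E) (adj_mat E) \<Longrightarrow> regular_graph E"
    by (rule signless_adj_commute_regular[OF E(2) Q[OF _ sym(1)]])
  show "power_eq_poly (laplacian E) (adj_mat E) \<Longrightarrow> regular_graph E"
    by (rule laplacian_adj_commute_regular[OF E(2) L[OF _ sym(1)]])
  show "power_eq_poly (signless_laplacian E) (laplacian E) \<Longrightarrow> regular_graph E"
    by (rule signless_laplacian_commute_regular[OF E(2) Q[OF _ sym(3)]])
  show "power_eq_poly (laplacian E) (signless_laplacian E) \<Longrightarrow> regular_graph E"
    by (rule signless_laplacian_commute_regular[OF E(2) L[OF _ sym(2), symmetric]])
  show "power_eq_poly (normalized_laplacian E) (signless_laplacian E) \<Longrightarrow> regular_graph E"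
    by (rule normalized_signless_commute_regular[OF E N[OF _ sym(2)]])
  show "power_eq_poly (signless_laplacian E) (normalized_laplacian E) \<Longrightarrow> regular_graph E"
    by (rule normalized_signless_commute_regular[OF E Q[OF _ sym(4), symmetric]])
  show "power_eq_poly (normalized_laplacian E) (laplacian E) \<Longrightarrow> regular_graph E"
    by (rule normalized_laplacian_commute_regular[OF E N[OF _ sym(3)]])
  show "power_eq_poly (laplacian E) (normalized_laplacian E) \<Longrightarrow> regular_graph E"
    by (rule normalized_laplacian_commute_regular[OF E L[OF _ sym(4), symmetric]])
qed

lemma power_eq_poly_regular_or_biregular:
  assumes E: "simple_graph E" "connected_graph E" "no_isolated_vertices E"
  shows "power_eq_poly (normalized_laplacian E) (adj_mat E) \<Longrightarrow> regular_graph E \<or> biregular_graph E"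
    and "power_eq_poly (adj_mat E) (signless_laplacian E) \<Longrightarrow> regular_graph E \<or> biregular_graph E"
    and "power_eq_poly (adj_mat E) (laplacian E) \<Longrightarrow> regular_graph E \<or> biregular_graph E"
proof -
  note sym = transpose_adj_mat[OF E(1)] transpose_graph_matrices[OF E(1)]
  show "regular_graph E \<or> biregular_graph E"
    if "power_eq_poly (normalized_laplacian E) (adj_mat E)"
    using power_eq_poly_commute[OF that trace_positive_normalized_laplacian[OF E(1)] sym(1)]
    by (intro regular_or_biregularI[OF E] normalized_adj_commute_common[OF E(1,3)])
  show "regular_graph E \<or> biregular_graph E" if "power_eq_poly (adj_mat E) (signless_laplacian E)"
    using power_eq_poly_adj_commute[OF E(1) that sym(2)]
    by (intro regular_or_biregularI[OF E] adj_square_commute_common[OF E(1)]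
        adj_square_signless_commute)
  show "regular_graph E \<or> biregular_graph E" if "power_eq_poly (adj_mat E) (laplacian E)"
    using power_eq_poly_adj_commute[OF E(1) that sym(3)]
    by (intro regular_or_biregularI[OF E] adj_square_commute_common[OF E(1)]
        adj_square_laplacian_commute)
qed

theorem theorem1p2:
  fixes E :: "'n::finite \<Rightarrow> 'n \<Rightarrow> bool"
    and A Q L N :: "real ^ 'n ^ 'n"
  assumes "simple_graph E"
    and "connected_graph E"
    and "no_isolated_vertices E"
    and "A = adj_mat E"
    and "Q = signless_laplacian E"
    and "L = laplacian E"
    and "N = normalized_laplacian E"
  shows
    "(regular_graph E \<longrightarrow>
        (\<forall>X\<in>{A, Q, L, N}. \<forall>Y\<in>{A, Q, L, N}. power_eq_poly X Y) \<and>
        (\<forall>X\<in>{A, Q, L, N}. \<forall>Y\<in>{A, Q, L, N}.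
           \<exists>a b. a \<noteq> 0 \<and> X = a *\<^sub>R Y + b *\<^sub>R mat 1)) \<and>
     (\<forall>d1 d2. biregular_with E d1 d2 \<longrightarrow>
        power_eq_poly A Q \<and> power_eq_poly A L \<and> power_eq_poly A N \<and> power_eq_poly N A \<and>
        (Q - real d1 *\<^sub>R mat 1) ** (Q - real d2 *\<^sub>R mat 1) = mat_pow A 2 \<and>
        (L - real d1 *\<^sub>R mat 1) ** (L - real d2 *\<^sub>R mat 1) = mat_pow A 2 \<and>
        N = mat 1 - (1 / sqrt (real d1 * real d2)) *\<^sub>R A \<and>
        (\<not> regular_graph E \<longrightarrow>
           \<not> power_eq_poly Q A \<and> \<not> power_eq_poly L A \<and>
           \<not> power_eq_poly Q L \<and> \<not> power_eq_poly L Q \<and>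
           \<not> power_eq_poly N Q \<and> \<not> power_eq_poly Q N \<and>
           \<not> power_eq_poly N L \<and> \<not> power_eq_poly L N)) \<and>
     (\<not> regular_graph E \<and> \<not> biregular_graph E \<longrightarrow>
        (\<forall>X\<in>{A, Q, L, N}. \<forall>Y\<in>{A, Q, L, N}.
           X \<noteq> Y \<and> (X, Y) \<noteq> (A, N) \<longrightarrow> \<not> power_eq_poly X Y))"
proof -
  let ?M = "{A, Q, L, N}"
  note E = assms(1-3) and defs = assms(4-7)
  have regular: "\<exists>a b. a \<noteq> 0 \<and> X = a *\<^sub>R Y + b *\<^sub>R mat 1"
    if "regular_graph E" "X \<in> ?M" "Y \<in> ?M" for X Y
    using regular_graph_affine[OF that(1) E(3)] that(2,3) unfolding defs by blast
  have regular_power: "power_eq_poly X Y" if "regular_graph E" "X \<in> ?M" "Y \<in> ?M" for X Y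
    using regular[OF that] power_eq_poly_linear by blast

  have biregular: "(Q - real d1 *\<^sub>R mat 1) ** (Q - real d2 *\<^sub>R mat 1) = mat_pow A 2"
      "(L - real d1 *\<^sub>R mat 1) ** (L - real d2 *\<^sub>R mat 1) = mat_pow A 2"
      "N = mat 1 - (1 / sqrt (real d1 * real d2)) *\<^sub>R A"
    if "biregular_with E d1 d2" for d1 d2
    using biregular_product[OF that, of 1] biregular_product[OF that, of "-1"]
      biregular_normalized_laplacian[OF that E(3)]
    by (simp_all add: defs signless_laplacian_def laplacian_def)
  have biregular_power: "power_eq_poly A Q" "power_eq_poly A L" "power_eq_poly A N" "power_eq_poly N A"
    if "biregular_with E d1 d2" for d1 d2
    using power_eq_poly_quadratic[OF biregular(1)[OF that]]
      power_eq_poly_quadratic[OF biregular(2)[OF that]]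
      biregular_power_eq_poly_adj_normalized[OF that E(3)]
    unfolding defs by blast+

  have not_regular: "\<not> power_eq_poly Q A" "\<not> power_eq_poly L A" "\<not> power_eq_poly Q L"
      "\<not> power_eq_poly L Q" "\<not> power_eq_poly N Q" "\<not> power_eq_poly Q N" "\<not> power_eq_poly N L"
      "\<not> power_eq_poly L N"
    if "\<not> regular_graph E"
    using power_eq_poly_regular[OF E] that unfolding defs by blast+
  have neither: "\<not> power_eq_poly X Y"
    if "\<not> regular_graph E" "\<not> biregular_graph E" "X \<in> ?M" "Y \<in> ?M" "X \<noteq> Y" "(X, Y) \<noteq> (A, N)" for X Y
  proof -
    have "\<not> power_eq_poly N A" "\<not> power_eq_poly A Q" "\<not> power_eq_poly A L"
      using power_eq_poly_regular_or_biregular[OF E] that(1,2) unfolding defs by blast+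
    then show ?thesis
      using that(3-) not_regular[OF that(1)] by blast
  qed
  show ?thesis
    by (intro conjI allI impI ballI; (elim conjE)?;
        rule regular regular_power biregular biregular_power not_regular neither; assumption)
qed

end
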